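(* Let $b \ge 2$ be an integer, let $r \in \{0, 1, \dots, b-1\}$ and let $i \ge 1$ be an integer, all fixed. Then, as $T \to +\infty$, \[ \sum_{\substack{(n, m) \in \mathcal{A}(T; b, r; i) \\ \gcd(n, m) = 1}} 1 = \frac{c(b, r; i)}{\zeta(2)}\, T^2 + O\bigl( T \log^2(T) \bigr), \] where $\zeta$ denotes the Riemann zeta function and the implicit constant may depend on $b$, $r$ and $i$.
   Context: For a positive real number $x$, an integer $b \ge 2$ and a positive integer $i$, let $\phi(x; b; i)$ be the $i$-th digit to the right of the point in the representation of $x$ in base $b$, i.e. \[ \phi(x; b; i) = \bigl\lfloor b \{ b^{i-1} x \} \bigr\rfloor , \] where $\lfloor \cdot \rfloor$ and $\{\cdot\}$ denote the integer part and the fractional part. For $r \in \{0, \dots, b-1\}$ and real $T \ge 1$ put \[ \mathcal{A}(T; b, r; i) = \{ (n, m) \in \mathbb{N}^2 \cap [1, T]^2 : \phi(n/m; b; i) = r \}. \] The constant $c(b, r; i)$ is \[ c(b, r; i) = \frac{1}{2b} + \frac12 b^i \int_0^1 \frac{1 - \varphi}{1 - \varphi^b}\, \varphi^{b^i + r - 1} \, \mathrm{d}\varphi = \frac{1}{2b} + \frac12 b^{i-1} \Bigl( \psi\Bigl( \frac{b^i + r + 1}{b} \Bigr) - \psi\Bigl( \frac{b^i + r}{b} \Bigr) \Bigr), \] where $\psi = \Gamma'/\Gamma$ is the digamma function. *)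

theory Defs
  imports "HOL-Analysis.Analysis" "HOL-Library.Landau_Symbols"
begin

definition base_digit :: "real \<Rightarrow> nat \<Rightarrow> nat \<Rightarrow> int" where
  "base_digit x b i = \<lfloor>real b * frac (real b ^ (i - 1) * x)\<rfloor>"

definition digit_pairs :: "real \<Rightarrow> nat \<Rightarrow> nat \<Rightarrow> nat \<Rightarrow> (nat \<times> nat) set" where
  "digit_pairs T b r i =
     {(n, m). real n \<in> {1..T} \<and> real m \<in> {1..T} \<and>
              base_digit (real n / real m) b i = int r}"

(* At the endpoint u = 1 the integrand reads 0 / 0 = 0 instead of its continuous
   extension 1 / b, which does not affect the integral. For b \<ge> 2 and i \<ge> 1 the
   exponent is a truncation-free subtraction. Expanding 1 / (1 - u ^ b) as a geometric
   series, the constant is also equal to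
     1 / (2 * b) + b ^ (i - 1) / 2 * (Digamma ((b ^ i + r + 1) / b) - Digamma ((b ^ i + r) / b)). *)
definition digit_const :: "nat \<Rightarrow> nat \<Rightarrow> nat \<Rightarrow> real" where
  "digit_const b r i =
     1 / (2 * real b) +
     1 / 2 * real b ^ i *
       integral {0..1} (\<lambda>u::real. (1 - u) / (1 - u ^ b) * u ^ (b ^ i + r - 1))"

(* The Riemann zeta function on the half-line s > 1, where it is given by its
   Dirichlet series; no analytic continuation is provided. *)
definition zeta :: "real \<Rightarrow> real" where
  "zeta s = (\<Sum>n. 1 / real (Suc n) powr s)"

end

theory Submission
  imports Defs "HOL-Computational_Algebra.Squarefree" "HOL-Real_Asymp.Real_Asymp"
begin

text \<open>
  Put \<open>a = b ^ i\<close>. The \<open>i\<close>-th digit of \<open>n / m\<close> is \<open>r\<close> iff \<open>\<lfloor>a * n / m\<rfloor> \<equiv> r\<close> modulo \<open>b\<close>, a condition that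
  depends on the ratio \<open>n / m\<close> only. For fixed \<open>m \<le> N\<close> the admissible \<open>n \<le> N\<close> are the integers in \<open>O(N / m)\<close>
  intervals, so they number as much as the total length of these intervals up to \<open>O(N / m)\<close>. (Fixing \<open>n\<close>
  instead would only give the error \<open>O(N ^ (3 / 2))\<close>.) That length, as a function of \<open>m\<close>, varies by \<open>O(N / m)\<close>
  on unit intervals, so its sum over \<open>m\<close> is its integral, \<open>c * N\<^sup>2 + O(N)\<close>, up to \<open>O(N * ln N)\<close>. Hence there
  are \<open>c * N\<^sup>2 + O(N * ln N)\<close> pairs without the coprimality condition, and Moebius inversion costs one
  more logarithm.
\<close>

section \<open>The Moebius function\<close>

definition moebius :: "nat \<Rightarrow> real" where
  "moebius n = (if squarefree n then (-1) ^ card (prime_factors n) else 0)"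

lemma abs_moebius_le: "\<bar>moebius n\<bar> \<le> 1"
  by (simp add: moebius_def power_abs)

lemma moebius_prime_mult:
  assumes "prime p" "\<not> p dvd d"
  shows "moebius (p * d) = - moebius d"
proof (cases "squarefree d")
  case True
  have cop: "coprime p d"
    using assms by (simp add: prime_imp_coprime)
  have "squarefree (p * d)"
    using cop assms(1) True by (simp add: squarefree_mult_coprime squarefree_prime)
  moreover have "prime_factors (p * d) = insert p (prime_factors d)"
    using assms True by (cases "d = 0") (auto simp: prime_factors_product prime_factorization_prime)
  moreover have "p \<notin> prime_factors d"
    using assms by auto
  ultimately show ?thesis
    using True by (simp add: moebius_def)
next
  case False
  then have "\<not> squarefree (p * d)"
    using squarefree_multD(2) by blast
  with False show ?thesis by (simp add: moebius_def)
qed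

text \<open>For a prime \<open>p\<close> dividing \<open>n\<close>, each divisor \<open>d\<close>
  prime to \<open>p\<close> cancels against the divisor \<open>p * d\<close>. All remaining divisors
  are multiples of \<open>p\<^sup>2\<close>, where \<open>moebius\<close> vanishes.\<close>

lemma sum_moebius_divisors:
  assumes "n > 0"
  shows "(\<Sum>d | d dvd n. moebius d) = (if n = 1 then 1 else 0)"
proof (cases "n = 1")
  case True
  then show ?thesis by (simp add: moebius_def)
next
  case False
  then obtain p where p: "prime p" "p dvd n"
    using prime_factor_nat by blast
  have fin: "finite {d. d dvd n}" using assms by simp
  let ?A = "{d. d dvd n \<and> \<not> p dvd d}"
  have "(\<Sum>d | d dvd n. moebius d) = (\<Sum>d\<in>?A \<union> (*) p ` ?A. moebius d)"
  proof (rule sum.mono_neutral_right[OF fin])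
    have "p * d dvd n" if "d dvd n" "\<not> p dvd d" for d
      using that p by (simp add: divides_mult prime_imp_coprime)
    then show "?A \<union> (*) p ` ?A \<subseteq> {d. d dvd n}" by auto
    show "\<forall>d\<in>{d. d dvd n} - (?A \<union> (*) p ` ?A). moebius d = 0"
    proof
      fix d assume d: "d \<in> {d. d dvd n} - (?A \<union> (*) p ` ?A)"
      then obtain e where e: "d = p * e" by auto
      \<comment> \<open>Otherwise \<open>e\<close> would be a divisor of \<open>n\<close> prime to
        \<open>p\<close>, and \<open>d = p * e\<close> would lie in the image of
        \<open>?A\<close>.\<close>
      then have "p dvd e" using d by (auto dest: dvd_mult_right)
      then have "p\<^sup>2 dvd d" using e by (simp add: power2_eq_square mult_dvd_mono)
      then have "\<not> squarefree d" using p(1) by (auto simp: squarefree_def)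
      then show "moebius d = 0" by (simp add: moebius_def)
    qed
  qed
  also have "\<dots> = (\<Sum>d\<in>?A. moebius d) + (\<Sum>d\<in>(*) p ` ?A. moebius d)"
    using fin by (intro sum.union_disjoint) auto
  also have "(\<Sum>d\<in>(*) p ` ?A. moebius d) = (\<Sum>d\<in>?A. moebius (p * d))"
    using p by (subst sum.reindex) (auto simp: inj_on_def)
  also have "\<dots> = - (\<Sum>d\<in>?A. moebius d)"
    using p by (simp add: moebius_prime_mult sum_negf)
  finally show ?thesis using False by simp
qed

section \<open>Harmonic sums and truncated series around zeta(2)\<close>

lemma sum_inverse_le: "(\<Sum>m = 1..N. 1 / real m) \<le> 1 + ln N"
proof (induction N)
  case (Suc N)
  show ?case
  proof (cases "N = 0")
    case False
    \<comment> \<open>This is \<open>ln x \<le> x - 1\<close> at \<open>x = N / (N + 1)\<close>. It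
      fails for \<open>N = 0\<close>, where \<open>ln 0 = 0\<close>.\<close>
    have "1 / real (Suc N) \<le> ln (real (Suc N)) - ln (real N)"
      using False ln_le_minus_one[of "real N / real (Suc N)"]
      by (simp add: ln_div field_simps)
    then show ?thesis using Suc by simp
  qed simp
qed simp

text \<open>Collecting the terms with \<open>n = d * k\<close>, the coefficient of
  \<open>f n\<close> is the sum of \<open>moebius\<close> over the divisors of \<open>n\<close>,
  which is 0 except at \<open>n = 1\<close>.\<close>

lemma sum_moebius_multiples:
  fixes f :: "nat \<Rightarrow> real"
  assumes "N > 0"
  shows "(\<Sum>d = 1..N. moebius d * (\<Sum>k = 1..N div d. f (d * k))) = f 1"
proof -
  have "(\<Sum>d = 1..N. moebius d * (\<Sum>k = 1..N div d. f (d * k)))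
      = (\<Sum>d = 1..N. \<Sum>n \<in> {n \<in> {1..N}. d dvd n}. moebius d * f n)"
  proof (rule sum.cong[OF refl])
    fix d assume d: "d \<in> {1..N}"
    have "{n \<in> {1..N}. d dvd n} = (*) d ` {1..N div d}"
    proof (intro equalityI subsetI)
      fix n assume "n \<in> {n \<in> {1..N}. d dvd n}"
      then obtain k where k: "n = d * k" "1 \<le> d * k" "d * k \<le> N" by auto
      then have "k \<in> {1..N div d}"
        using d by (cases "k = 0") (auto simp: less_eq_div_iff_mult_less_eq mult.commute)
      then show "n \<in> (*) d ` {1..N div d}" using k by blast
    next
      fix n assume "n \<in> (*) d ` {1..N div d}"
      then show "n \<in> {n \<in> {1..N}. d dvd n}"
        using d by (auto simp: less_eq_div_iff_mult_less_eq mult.commute intro!: Suc_leI)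
    qed
    then show "moebius d * (\<Sum>k = 1..N div d. f (d * k))
        = (\<Sum>n \<in> {n \<in> {1..N}. d dvd n}. moebius d * f n)"
      using d by (simp add: sum_distrib_left sum.reindex inj_on_def)
  qed
  also have "\<dots> = (\<Sum>n = 1..N. \<Sum>d \<in> {d \<in> {1..N}. d dvd n}. moebius d * f n)"
    by (rule sum.swap_restrict) auto
  also have "\<dots> = (\<Sum>n = 1..N. if n = 1 then f n else 0)"
  proof (rule sum.cong[OF refl])
    fix n assume n: "n \<in> {1..N}"
    then have "{d \<in> {1..N}. d dvd n} = {d. d dvd n}"
      by (auto intro: Suc_leI dest: dvd_imp_le intro!: Nat.gr0I)
    then show "(\<Sum>d \<in> {d \<in> {1..N}. d dvd n}. moebius d * f n) = (if n = 1 then f n else 0)"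
      using n sum_moebius_divisors[of n] by (simp flip: sum_distrib_right)
  qed
  also have "\<dots> = f 1" using assms by simp
  finally show ?thesis .
qed

text \<open>The tail is dominated termwise by a telescoping series, through
  \<open>1 / x\<^sup>2 \<le> 2 * (1 / x - 1 / (x + 1))\<close> for \<open>x \<ge> 1\<close>. The
  factor 2 makes the bound valid from \<open>n = 0\<close> on. The lower bound 1 is the first term
  of the series.\<close>

lemma zeta_2_tail:
  shows "\<bar>zeta 2 - (\<Sum>k = 1..n. 1 / (real k)\<^sup>2)\<bar> \<le> 2 / (real n + 1)" and "zeta 2 \<ge> 1"
proof -
  let ?f = "\<lambda>n. 1 / (real (Suc n))\<^sup>2"
  have f: "1 / real (Suc n) powr 2 = ?f n" for n
    by (subst powr_numeral) auto
  have sm: "summable ?f"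
    using inverse_power_summable[of 2, where ?'a = real] 
    by (subst summable_Suc_iff) (simp add: inverse_eq_divide power_divide)
  have z: "zeta 2 = (\<Sum>n. ?f n)" unfolding zeta_def f ..
  have sp: "zeta 2 = (\<Sum>k. ?f (k + n)) + (\<Sum>k<n. ?f k)" for n
    unfolding z by (rule suminf_split_initial_segment[OF sm])
  have e: "(\<Sum>k<n. ?f k) = (\<Sum>k = 1..n. 1 / (real k)\<^sup>2)" for n
    by (simp add: sum.atLeast1_atMost_eq lessThan_Suc_atMost)
  have sm': "summable (\<lambda>k. ?f (k + n))" for n
    using sm by (rule summable_ignore_initial_segment)
  have nn: "(\<Sum>k. ?f (k + n)) \<ge> 0" for n
    by (intro suminf_nonneg sm') auto
  show "zeta 2 \<ge> 1" using sp[of 1] nn[of 1] by simp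
  have tel: "(\<lambda>k. 1 / real (k + n + 1) - 1 / real (Suc k + n + 1)) sums (1 / real (0 + n + 1) - 0)"
    by (rule telescope_sums') real_asymp
  have "(\<Sum>k. ?f (k + n)) \<le> (\<Sum>k. 2 * (1 / real (k + n + 1) - 1 / real (Suc k + n + 1)))"
  proof (intro suminf_le sm')
    show "summable (\<lambda>k. 2 * (1 / real (k + n + 1) - 1 / real (Suc k + n + 1)))"
      using tel by (intro summable_mult) (rule sums_summable)
    fix k
    have "1 / x\<^sup>2 \<le> 2 * (1 / x - 1 / (x + 1))" if "x \<ge> 1" for x :: real
    proof -
      have "x * (x + 1) \<le> 2 * x\<^sup>2" using that by (simp add: algebra_simps power2_eq_square)
      then have "2 / (2 * x\<^sup>2) \<le> 2 / (x * (x + 1))" using that by (intro divide_left_mono) auto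
      also have "\<dots> = 2 * (1 / x - 1 / (x + 1))" using that by (simp add: field_simps)
      finally show ?thesis by simp
    qed
    from this[of "real (Suc (k + n))"]
    show "?f (k + n) \<le> 2 * (1 / real (k + n + 1) - 1 / real (Suc k + n + 1))"
      by (simp add: algebra_simps)
  qed
  also have "\<dots> = 2 * (1 / (real n + 1))"
    using sums_mult[OF tel, of 2] by (simp add: sums_iff)
  finally show "\<bar>zeta 2 - (\<Sum>k = 1..n. 1 / (real k)\<^sup>2)\<bar> \<le> 2 / (real n + 1)"
    using sp[of n] nn[of n] e[of n] by simp
qed

text \<open>
  A truncated form of \<open>(\<Sum>d. moebius d / d\<^sup>2) * zeta 2 = 1\<close> that needs no product of infinite series.
\<close>
lemma sum_moebius_squares:
  assumes "N > 0"
  shows "\<bar>(\<Sum>d = 1..N. moebius d / (real d)\<^sup>2) - 1 / zeta 2\<bar> \<le> 2 * (1 + ln N) / N"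
proof -
  let ?s = "\<lambda>n. \<Sum>k = 1..n. 1 / (real k)\<^sup>2"
  have z: "zeta 2 \<ge> 1" by (rule zeta_2_tail)
  have "1 = (\<Sum>d = 1..N. moebius d * (\<Sum>k = 1..N div d. 1 / (real (d * k))\<^sup>2))"
    using sum_moebius_multiples[OF assms, of "\<lambda>n. 1 / (real n)\<^sup>2"] by simp
  also have "\<dots> = (\<Sum>d = 1..N. moebius d / (real d)\<^sup>2 * ?s (N div d))"
    by (simp add: sum_distrib_left power_mult_distrib)
  finally have "(\<Sum>d = 1..N. moebius d / (real d)\<^sup>2) * zeta 2 - 1
      = (\<Sum>d = 1..N. moebius d / (real d)\<^sup>2 * (zeta 2 - ?s (N div d)))"
    by (simp add: sum_distrib_right sum_subtractf right_diff_distrib)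
  also have "\<bar>\<dots>\<bar> \<le> (\<Sum>d = 1..N. 2 / N * (1 / real d))"
  proof (rule order_trans[OF sum_abs sum_mono])
    fix d assume d: "d \<in> {1..N}"
    \<comment> \<open>Since \<open>N div d + 1 > N / d\<close>, the tail of zeta(2) beyond
      \<open>N div d\<close> is at most \<open>2 * d / N\<close>. The weight
      \<open>1 / d\<^sup>2\<close> turns this into a harmonic term.\<close>
    have "N < (N div d + 1) * d"
      using d dividend_less_div_times[of d N] by simp
    then have "real N < (real (N div d) + 1) * real d"
      by (metis of_nat_1 of_nat_add of_nat_less_iff of_nat_mult)
    then have "2 / (real (N div d) + 1) \<le> 2 * d / N"
      using assms by (simp add: field_simps)
    then have "\<bar>zeta 2 - ?s (N div d)\<bar> \<le> 2 * d / N"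
      using zeta_2_tail(1)[of "N div d"] by linarith
    moreover have "\<bar>moebius d / (real d)\<^sup>2\<bar> \<le> 1 / (real d)\<^sup>2"
      using abs_moebius_le[of d] by (simp add: divide_right_mono)
    ultimately have "\<bar>moebius d / (real d)\<^sup>2 * (zeta 2 - ?s (N div d))\<bar> \<le> 1 / (real d)\<^sup>2 * (2 * d / N)"
      unfolding abs_mult by (intro mult_mono) auto
    also have "\<dots> = 2 / N * (1 / real d)"
      using d by (simp add: power2_eq_square)
    finally show "\<bar>moebius d / (real d)\<^sup>2 * (zeta 2 - ?s (N div d))\<bar> \<le> 2 / N * (1 / real d)" .
  qed
  also have "\<dots> = 2 / N * (\<Sum>d = 1..N. 1 / real d)"
    by (simp add: sum_distrib_left)
  also have "\<dots> \<le> 2 / N * (1 + ln N)"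
    by (intro mult_left_mono sum_inverse_le) auto
  finally have *: "\<bar>(\<Sum>d = 1..N. moebius d / (real d)\<^sup>2) * zeta 2 - 1\<bar> \<le> 2 * (1 + ln N) / N"
    by simp
  \<comment> \<open>Dividing by \<open>zeta 2 \<ge> 1\<close> does not increase the error.\<close>
  have "\<bar>(\<Sum>d = 1..N. moebius d / (real d)\<^sup>2) - 1 / zeta 2\<bar>
      = \<bar>(\<Sum>d = 1..N. moebius d / (real d)\<^sup>2) * zeta 2 - 1\<bar> / zeta 2"
    using z by (simp add: abs_if field_simps)
  also have "\<dots> \<le> \<bar>(\<Sum>d = 1..N. moebius d / (real d)\<^sup>2) * zeta 2 - 1\<bar> / 1"
    using z by (intro divide_left_mono) auto
  finally show ?thesis using * by simp
qed

section \<open>Counting along rows\<close>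

text \<open>For \<open>0 < x \<le> N\<close> the count is \<open>\<lceil>x\<rceil> - 1\<close>, and
  for \<open>x > N\<close> it saturates at \<open>N\<close>. The error is kept one-sided so that the
  difference of two such counts is off by at most 1.\<close>

lemma card_nat_below:
  fixes x :: real
  assumes "x \<ge> 0"
  shows "real (card {n \<in> {1..N}. real n < x}) \<in> {min (real N) x - 1..min (real N) x}"
proof (cases "x > real N")
  case True
  then have "{n \<in> {1..N}. real n < x} = {1..N}" by auto
  then show ?thesis using True by simp
next
  case False
  have "{n \<in> {1..N}. real n < x} = {1..<nat \<lceil>x\<rceil>}"
  proof (intro set_eqI iffI)
    fix n assume "n \<in> {n \<in> {1..N}. real n < x}"
    then show "n \<in> {1..<nat \<lceil>x\<rceil>}" by (auto simp: zless_nat_eq_int_zless less_ceiling_iff)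
  next
    fix n assume "n \<in> {1..<nat \<lceil>x\<rceil>}"
    then have "1 \<le> n" "real n < x" by (auto simp: zless_nat_eq_int_zless less_ceiling_iff)
    then show "n \<in> {n \<in> {1..N}. real n < x}" using False by auto
  qed
  then have "card {n \<in> {1..N}. real n < x} = nat \<lceil>x\<rceil> - 1" by simp
  moreover have "x \<le> of_int \<lceil>x\<rceil>" "of_int \<lceil>x\<rceil> < x + 1" by linarith+
  \<comment> \<open>At \<open>x = 0\<close> the natural subtraction truncates to 0, hence the later
    case split.\<close>
  moreover have "real (nat \<lceil>x\<rceil> - 1) = of_int \<lceil>x\<rceil> - 1" if "x > 0" using that by linarith
  ultimately show ?thesis
    using False assms by (cases "x = 0") auto
qed

text \<open>
  With \<open>a = b ^ i\<close>, the digit condition on \<open>n / m\<close> says that \<open>q * m / a \<le> n < (q + 1) * m / a\<close> for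
  some \<open>q \<equiv> r\<close> modulo \<open>b\<close>. The function \<open>sector_length\<close> is the length of the set of real \<open>n \<in> [0, N]\<close>
  satisfying this at height \<open>m = x\<close>, where the cutoff \<open>j < L\<close> loses nothing on integer heights
  once \<open>a * N < b * L\<close>.
\<close>
definition clip :: "nat \<Rightarrow> real \<Rightarrow> nat \<Rightarrow> real \<Rightarrow> real" where
  "clip N a q x = min (real N) (real q * x / a)"

definition sector_length :: "nat \<Rightarrow> real \<Rightarrow> nat \<Rightarrow> nat \<Rightarrow> nat \<Rightarrow> real \<Rightarrow> real" where
  "sector_length N a b r L x = (\<Sum>j<L. clip N a (Suc (b * j + r)) x - clip N a (b * j + r) x)"

text \<open>Each \<open>j\<close> gives one interval of \<open>n\<close>, whose count is off by at
  most 1 from its length. Once \<open>j * m > a * N\<close>, both endpoints are clipped to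
  \<open>N\<close> and the error is 0. So only \<open>a * N / m + 1\<close> values of
  \<open>j\<close> matter.\<close>

lemma row_count:
  fixes a b r N m L :: nat
  assumes "a > 0" "b > 0" "r < b" "1 \<le> m" "m \<le> N" "a * N < b * L"
  shows "\<bar>real (card {n \<in> {1..N}. (a * n div m) mod b = r}) - sector_length N a b r L m\<bar>
           \<le> (real a + 1) * N / m"
proof -
  let ?q = "\<lambda>j. b * j + r"
  define C where "C q = card {n \<in> {1..N}. real n < real q * m / a}" for q
  have "{n \<in> {1..N}. (a * n div m) mod b = r} = (\<Union>j<L. {n \<in> {1..N}. a * n div m = ?q j})"
  proof (intro equalityI subsetI)
    fix n assume "n \<in> {n \<in> {1..N}. (a * n div m) mod b = r}"
    then have n: "n \<in> {1..N}" and r: "a * n div m mod b = r" by auto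
    have "a * n div m \<le> a * N"
      using n by (meson atLeastAtMost_iff div_le_dividend le_trans mult_le_mono2)
    then have "a * n div m < b * L" using assms by linarith
    then have "a * n div m div b < L"
      using assms by (simp add: less_mult_imp_div_less mult.commute)
    moreover have "a * n div m = ?q (a * n div m div b)"
      using r by (metis mult_div_mod_eq)
    ultimately show "n \<in> (\<Union>j<L. {n \<in> {1..N}. a * n div m = ?q j})"
      using n by blast
  qed (use assms in auto)
  then have "real (card {n \<in> {1..N}. (a * n div m) mod b = r})
      = real (\<Sum>j<L. card {n \<in> {1..N}. a * n div m = ?q j})"
    using assms by (subst card_UN_disjoint[symmetric]) auto
  also have "\<dots> = (\<Sum>j<L. real (C (Suc (?q j))) - real (C (?q j)))"
  proof -
    have "real (card {n \<in> {1..N}. a * n div m = q}) = real (C (Suc q)) - real (C q)" for q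
    proof -
      have lt: "real n < real q * m / a \<longleftrightarrow> a * n div m < q" for n q
      proof -
        have "real n < real q * m / a \<longleftrightarrow> real (a * n) < real (q * m)"
          using assms by (simp add: field_simps)
        also have "\<dots> \<longleftrightarrow> a * n div m < q"
          unfolding of_nat_less_iff using assms by (simp add: div_less_iff_less_mult)
        finally show ?thesis .
      qed
      have "{n \<in> {1..N}. real n < real (Suc q) * m / a}
          = {n \<in> {1..N}. a * n div m = q} \<union> {n \<in> {1..N}. real n < real q * m / a}"
        unfolding lt by auto
      then have "C (Suc q) = card {n \<in> {1..N}. a * n div m = q} + C q"
        unfolding C_def using lt by (subst card_Un_disjoint[symmetric]) auto
      then show ?thesis by simp
    qed
    then show ?thesis by simp
  qed
  finally have card_eq: "real (card {n \<in> {1..N}. (a * n div m) mod b = r})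
      = (\<Sum>j<L. real (C (Suc (?q j))) - real (C (?q j)))" .
  have near: "real (C q) \<in> {clip N a q m - 1..clip N a q m}" for q
    unfolding C_def clip_def by (rule card_nat_below) simp
  have far: "real (C q) = clip N a q m" if "q * m > a * N" for q
  proof -
    have "real (q * m) > real (a * N)" using that by (simp only: of_nat_less_iff)
    then have *: "real N < real q * m / a" using assms by (simp add: field_simps)
    then have "{n \<in> {1..N}. real n < real q * m / a} = {1..N}" by auto
    then show ?thesis using * by (simp add: C_def clip_def)
  qed
  let ?e = "\<lambda>j. (real (C (Suc (?q j))) - real (C (?q j))) - (clip N a (Suc (?q j)) m - clip N a (?q j) m)"
  have "\<bar>\<Sum>j<L. ?e j\<bar> \<le> (\<Sum>j<L. if j \<le> a * N div m then 1 else 0)"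
  proof (rule order_trans[OF sum_abs sum_mono])
    fix j
    show "\<bar>?e j\<bar> \<le> (if j \<le> a * N div m then 1 else 0)"
    proof (cases "j \<le> a * N div m")
      case True
      \<comment> \<open>Both rounding errors lie in \<open>[-1, 0]\<close>, so their difference is
        at most 1 in absolute value.\<close>
      then show ?thesis using near[of "?q j"] near[of "Suc (?q j)"] by auto
    next
      case False
      then have "a * N < j * m"
        using assms by (simp add: less_eq_div_iff_mult_less_eq)
      also have "j * m \<le> ?q j * m"
        using assms by (intro mult_right_mono) (auto intro: trans_le_add1)
      finally have "a * N < ?q j * m" .
      moreover from this have "a * N < Suc (?q j) * m" by simp
      ultimately show ?thesis using far[of "?q j"] far[of "Suc (?q j)"] False by simp
    qed
  qed
  also have "\<dots> = real (card {j. j < L \<and> j \<le> a * N div m})"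
    by (simp add: sum.If_cases Int_def)
  also have "\<dots> \<le> real (card {..a * N div m})"
    by (intro of_nat_mono card_mono) auto
  also have "\<dots> = real (a * N div m) + 1" by simp
  \<comment> \<open>The extra 1 is absorbed by \<open>N / m\<close>, because
    \<open>m \<le> N\<close>.\<close>
  also have "\<dots> \<le> real (a * N) / m + N / m"
    using assms by (intro add_mono of_nat_div_le_of_nat) auto
  also have "\<dots> = (real a + 1) * N / m"
    by (simp add: add_divide_distrib algebra_simps)
  finally show ?thesis
    unfolding card_eq sector_length_def by (simp add: sum_subtractf)
qed

text \<open>Each summand is the length of the part of \<open>[c q, c (q + 1)]\<close> inside
  \<open>[y, y']\<close>, with \<open>q = b * j + r\<close>. It is nonnegative, and for
  \<open>r < b\<close> these indices are distinct, so the sum is at most the telescoping sum over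
  all \<open>q < b * L\<close>.\<close>

lemma min_increment_bounds:
  fixes y y' :: real
  assumes "y \<le> y'" "mono c"
  shows "0 \<le> (\<Sum>j<L. (min y' (c (Suc (b * j + r))) - min y' (c (b * j + r)))
                 - (min y (c (Suc (b * j + r))) - min y (c (b * j + r))))"
    and "b > 0 \<Longrightarrow> r < b \<Longrightarrow>
           (\<Sum>j<L. (min y' (c (Suc (b * j + r))) - min y' (c (b * j + r)))
                 - (min y (c (Suc (b * j + r))) - min y (c (b * j + r)))) \<le> y' - y"
proof -
  define D where "D q = (min y' (c (Suc q)) - min y' (c q)) - (min y (c (Suc q)) - min y (c q))" for q
  have D: "D q \<ge> 0" for q
    using monoD[OF assms(2), of q "Suc q"] assms(1) unfolding D_def min_def by auto
  show "0 \<le> (\<Sum>j<L. (min y' (c (Suc (b * j + r))) - min y' (c (b * j + r)))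
                 - (min y (c (Suc (b * j + r))) - min y (c (b * j + r))))"
    using D unfolding D_def by (intro sum_nonneg) auto
  assume br: "b > 0" "r < b"
  have "(\<Sum>j<L. D (b * j + r)) = sum D ((\<lambda>j. b * j + r) ` {..<L})"
    using br by (subst sum.reindex) (auto simp: inj_on_def)
  also have "\<dots> \<le> sum D {..<b * L}"
  proof (rule sum_mono2)
    show "(\<lambda>j. b * j + r) ` {..<L} \<subseteq> {..<b * L}"
    proof safe
      fix j assume "j < L"
      then have "b * Suc j \<le> b * L" by (intro mult_le_mono2) simp
      then show "b * j + r < b * L" using br by simp
    qed
  qed (use D in auto)
  also have "\<dots> = (min y' (c (b * L)) - min y (c (b * L))) - (min y' (c 0) - min y (c 0))"
    using sum_lessThan_telescope[of "\<lambda>q. min y' (c q) - min y (c q)" "b * L"]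
    by (simp add: D_def algebra_simps)
  also have "\<dots> \<le> y' - y"
    using assms(1) unfolding min_def by auto
  finally show "(\<Sum>j<L. (min y' (c (Suc (b * j + r))) - min y' (c (b * j + r)))
                 - (min y (c (Suc (b * j + r))) - min y (c (b * j + r)))) \<le> y' - y"
    by (simp add: D_def)
qed

text \<open>
  By homogeneity \<open>sector_length\<close> equals \<open>x * G (N / x)\<close> with \<open>G\<close> increasing, 1-Lipschitz and \<open>G 0 = 0\<close>.
\<close>
lemma sector_length_near:
  fixes a b r N m L :: nat and x :: real
  assumes "a > 0" "b > 0" "r < b" "1 \<le> m" "real m - 1 \<le> x" "x \<le> m"
  shows "\<bar>sector_length N a b r L m - sector_length N a b r L x\<bar> \<le> 2 * N / m"
proof -
  define G where "G y = (\<Sum>j<L. min y (real (Suc (b * j + r)) / a) - min y (real (b * j + r) / a))" for y :: real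
  have mono: "mono (\<lambda>q. real q / a)" by (auto simp: mono_def divide_right_mono)
  have G_diff: "0 \<le> G y' - G y" "G y' - G y \<le> y' - y" if "y \<le> y'" for y y'
    using min_increment_bounds[OF that mono, where L = L and b = b and r = r] assms
    unfolding G_def sum_subtractf by simp_all
  have G0: "G 0 = 0" by (simp add: G_def)
  have scale: "sector_length N a b r L x = x * G (N / x)" if "x > 0" for x
  proof -
    have "clip N a q x = x * min (N / x) (real q / a)" for q
      using that by (simp add: clip_def min_mult_distrib_left mult.commute)
    then show ?thesis
      by (simp add: sector_length_def G_def sum_distrib_left right_diff_distrib)
  qed
  have m: "sector_length N a b r L m = m * G (N / m)"
    using assms by (intro scale) auto
  have G_nonneg: "0 \<le> G (N / m)" and G_le: "G (N / m) \<le> N / m"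
    using G_diff[of 0 "N / m"] G0 by auto
  show ?thesis
  proof (cases "x = 0")
    case True
    then have "real m = 1" using assms by simp
    have "sector_length N a b r L x = 0" by (simp add: True sector_length_def clip_def)
    then show ?thesis using m G_nonneg G_le \<open>real m = 1\<close> by simp
  next
    case False
    then have x: "x > 0" using assms by linarith
    have "N / m \<le> N / x" using x assms by (intro divide_left_mono) auto
    from G_diff[OF this] have d: "0 \<le> G (N / x) - G (N / m)" "G (N / x) - G (N / m) \<le> N / x - N / m" .
    have "x * (G (N / x) - G (N / m)) \<le> x * (N / x - N / m)"
      using x d by (intro mult_left_mono) auto
    also have "\<dots> = (m - x) * (N / m)" using x assms by (simp add: field_simps)
    also have "\<dots> \<le> 1 * (N / m)" using assms by (intro mult_right_mono) auto
    finally have 1: "x * (G (N / x) - G (N / m)) \<le> N / m" by simp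
    have 2: "0 \<le> x * (G (N / x) - G (N / m))" using x d by simp
    have "(m - x) * G (N / m) \<le> 1 * (N / m)"
      using assms G_nonneg G_le by (intro mult_mono) auto
    moreover have "0 \<le> (m - x) * G (N / m)" using assms G_nonneg by simp
    \<comment> \<open>Both terms of this decomposition lie in \<open>[0, N / m]\<close>: the first
      because \<open>G y \<le> y\<close>, the second by the Lipschitz bound, each time with
      \<open>m - x \<le> 1\<close>.\<close>
    moreover have "sector_length N a b r L m - sector_length N a b r L x
        = (m - x) * G (N / m) - x * (G (N / x) - G (N / m))"
      unfolding m scale[OF x] by (simp add: algebra_simps)
    ultimately show ?thesis using 1 2 by linarith
  qed
qed

text \<open>On each \<open>[m - 1, m]\<close> the right endpoint value replaces the integral. The
  error \<open>e m\<close> may depend on \<open>m\<close>, as the bound \<open>2 * N / m\<close> for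
  sector lengths does.\<close>

lemma sum_minus_integral_le:
  fixes f :: "real \<Rightarrow> real" and e :: "nat \<Rightarrow> real"
  assumes "continuous_on UNIV f"
    and "\<And>m x. 1 \<le> m \<Longrightarrow> m \<le> N \<Longrightarrow> real m - 1 \<le> x \<Longrightarrow> x \<le> m \<Longrightarrow> \<bar>f (real m) - f x\<bar> \<le> e m"
  shows "\<bar>(\<Sum>m = 1..N. f (real m)) - integral {0..real N} f\<bar> \<le> (\<Sum>m = 1..N. e m)"
  using assms(2)
proof (induction N)
  case (Suc N)
  have int: "f integrable_on {u..v}" for u v
    using assms(1) by (intro integrable_continuous_real) (auto intro: continuous_on_subset)
  have split: "integral {0..real (Suc N)} f = integral {0..real N} f + integral {real N..real (Suc N)} f"
    by (rule Henstock_Kurzweil_Integration.integral_combine[symmetric]) (use int in auto)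
  have "f (Suc N) - integral {real N..real (Suc N)} f = integral {real N..real (Suc N)} (\<lambda>x. f (Suc N) - f x)"
    using int by (subst integral_diff) auto
  also have "norm \<dots> \<le> e (Suc N) * (real (Suc N) - real N)"
    using int Suc.prems[of "Suc N"] assms(1)
    by (intro integral_bound) (auto intro!: continuous_intros intro: continuous_on_subset)
  finally have "\<bar>f (Suc N) - integral {real N..real (Suc N)} f\<bar> \<le> e (Suc N)" by simp
  moreover have "\<bar>(\<Sum>m = 1..N. f (real m)) - integral {0..real N} f\<bar> \<le> (\<Sum>m = 1..N. e m)"
    using Suc by auto
  ultimately show ?case unfolding split by simp
qed simp

section \<open>The main term\<close>

text \<open>The area is a triangle for \<open>k \<le> 1\<close>. For \<open>k > 1\<close> the line
  reaches height \<open>T\<close> at \<open>x = T / k\<close>, which leaves a triangle and a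
  rectangle.\<close>

lemma integral_min_linear:
  fixes T k :: real
  assumes "0 \<le> T" "0 \<le> k"
  shows "((\<lambda>x. min T (k * x)) has_integral (if k \<le> 1 then k / 2 else 1 - 1 / (2 * k)) * T\<^sup>2) {0..T}"
proof (cases "k \<le> 1")
  case True
  have "((\<lambda>x. k * x) has_integral (k * T\<^sup>2 / 2 - k * 0\<^sup>2 / 2)) {0..T}"
    using assms by (intro fundamental_theorem_of_calculus)
      (auto intro!: derivative_eq_intros simp flip: has_real_derivative_iff_has_vector_derivative)
  moreover have "min T (k * x) = k * x" if "x \<in> {0..T}" for x
  proof -
    have "k * x \<le> 1 * x" using that True by (intro mult_right_mono) auto
    then show ?thesis using that by simp
  qed
  ultimately show ?thesis using True by (subst has_integral_cong) auto
next
  case False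
  let ?h = "\<lambda>x. min T (k * x)"
  have Tk: "0 \<le> T / k" "T / k \<le> T" using assms False by (auto simp: field_simps mult_le_cancel_left1)
  have "((\<lambda>x. k * x) has_integral (k * (T / k)\<^sup>2 / 2 - k * 0\<^sup>2 / 2)) {0..T / k}"
    using Tk by (intro fundamental_theorem_of_calculus)
      (auto intro!: derivative_eq_intros simp flip: has_real_derivative_iff_has_vector_derivative)
  moreover have "?h x = k * x" if "x \<in> {0..T / k}" for x
    using that False by (simp add: field_simps)
  ultimately have 1: "(?h has_integral (k * (T / k)\<^sup>2 / 2)) {0..T / k}"
    by (subst has_integral_cong) auto
  have "((\<lambda>x. T) has_integral (T - T / k) * T) {T / k..T}"
    using has_integral_const_real[of T "T / k" T] Tk by simp
  moreover have "?h x = T" if "x \<in> {T / k..T}" for x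
    using that False by (simp add: field_simps)
  ultimately have 2: "(?h has_integral (T - T / k) * T) {T / k..T}"
    by (subst has_integral_cong) auto
  have "(?h has_integral k * (T / k)\<^sup>2 / 2 + (T - T / k) * T) {0..T}"
    using has_integral_combine[OF Tk 1 2] .
  moreover have "k * (T / k)\<^sup>2 / 2 + (T - T / k) * T = (1 - 1 / (2 * k)) * T\<^sup>2"
    using False by (simp add: field_simps power2_eq_square)
  ultimately show ?thesis using False by simp
qed

text \<open>
  The indices \<open>q = b * j + r\<close> with \<open>j < b ^ (i - 1)\<close> are the sectors of slope below 1 and contribute
  \<open>1 / (2 * b)\<close>; those with larger \<open>j\<close> give the series of the second term of the constant.
\<close>
lemma integral_sector_length:
  fixes b r i N J :: nat
  assumes "b > 0" "r < b" "i > 0"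
  shows "(sector_length N (b ^ i) b r (b ^ (i - 1) + J) has_integral
           (1 / (2 * real b) + real b ^ i / 2 *
              (\<Sum>j<J. 1 / real (b ^ i + r + b * j) - 1 / real (b ^ i + r + b * j + 1))) * (real N)\<^sup>2)
           {0..real N}"
proof -
  define a where "a = b ^ i"
  have a: "a = b * b ^ (i - 1)" using assms by (cases i) (auto simp: a_def)
  have a0: "a > 0" using assms by (simp add: a_def)
  have split: "(\<Sum>j<k + J. h j) = (\<Sum>j<k. h j) + (\<Sum>j<J. h (k + j))" for k and h :: "nat \<Rightarrow> real"
    by (induction J) simp_all
  \<comment> \<open>The normalised integral of \<open>clip N a q\<close>. Both formulas give 1/2 at
    \<open>q = a\<close>, so the second may be used for all \<open>q \<ge> a\<close>.\<close>
  define I where "I q = (if q \<le> a then real q / (2 * a) else 1 - real a / (2 * q))" for q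
  have clip: "(clip N a q has_integral I q * (real N)\<^sup>2) {0..real N}" for q
  proof -
    have "(if real q / a \<le> 1 then real q / a / 2 else 1 - 1 / (2 * (real q / a))) = I q"
      using a0 by (auto simp: I_def field_simps)
    then show ?thesis
      using integral_min_linear[of "real N" "real q / a"] a0
      by (simp add: clip_def[abs_def] del: times_divide_eq_right)
  qed
  have "(sector_length N a b r (b ^ (i - 1) + J) has_integral
          (\<Sum>j<b ^ (i - 1) + J. I (Suc (b * j + r)) * (real N)\<^sup>2 - I (b * j + r) * (real N)\<^sup>2)) {0..real N}"
    unfolding sector_length_def[abs_def]
    by (intro has_integral_sum has_integral_diff clip) auto
  also have "(\<Sum>j<b ^ (i - 1) + J. I (Suc (b * j + r)) * (real N)\<^sup>2 - I (b * j + r) * (real N)\<^sup>2)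
      = (\<Sum>j<b ^ (i - 1) + J. I (Suc (b * j + r)) - I (b * j + r)) * (real N)\<^sup>2"
    by (simp add: sum_distrib_right left_diff_distrib)
  also have "(\<Sum>j<b ^ (i - 1) + J. I (Suc (b * j + r)) - I (b * j + r))
      = (\<Sum>j<b ^ (i - 1). I (Suc (b * j + r)) - I (b * j + r))
        + (\<Sum>j<J. I (Suc (b * (b ^ (i - 1) + j) + r)) - I (b * (b ^ (i - 1) + j) + r))"
    by (rule split)
  also have "(\<Sum>j<b ^ (i - 1). I (Suc (b * j + r)) - I (b * j + r)) = (\<Sum>j<b ^ (i - 1). 1 / (2 * real a))"
  proof (rule sum.cong[OF refl])
    fix j assume "j \<in> {..<b ^ (i - 1)}"
    then have "b * Suc j \<le> a" unfolding a by (intro mult_le_mono2) auto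
    then have "Suc (b * j + r) \<le> a" using assms by simp
    then show "I (Suc (b * j + r)) - I (b * j + r) = 1 / (2 * real a)"
      by (simp add: I_def field_simps)
  qed
  also have "\<dots> = 1 / (2 * real b)"
    using assms by (simp add: a)
  also have "(\<Sum>j<J. I (Suc (b * (b ^ (i - 1) + j) + r)) - I (b * (b ^ (i - 1) + j) + r))
      = (\<Sum>j<J. real a / 2 * (1 / real (a + r + b * j) - 1 / real (a + r + b * j + 1)))"
  proof (rule sum.cong[OF refl])
    fix j
    have q: "b * (b ^ (i - 1) + j) + r = a + r + b * j" by (simp add: a algebra_simps)
    have I: "I q = 1 - real a / (2 * q)" if "q \<ge> a" for q
      using that a0 by (auto simp: I_def field_simps)
    have "I (Suc q) - I q = real a / 2 * (1 / real q - 1 / real (q + 1))" if "q \<ge> a" for q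
      using that I[of q] I[of "Suc q"] by (simp add: right_diff_distrib)
    from this[of "a + r + b * j"] show "I (Suc (b * (b ^ (i - 1) + j) + r)) - I (b * (b ^ (i - 1) + j) + r)
        = real a / 2 * (1 / real (a + r + b * j) - 1 / real (a + r + b * j + 1))"
      unfolding q by simp
  qed
  finally show ?thesis by (simp add: a_def sum_distrib_left)
qed

text \<open>Expanding \<open>1 / (1 - u ^ b)\<close> to \<open>J\<close> geometric terms and
  integrating the powers of \<open>u\<close> yields the partial series. The remainder integral lies
  in \<open>[0, 1 / J]\<close>.\<close>

lemma digit_const_approx:
  fixes b r i J :: nat
  assumes "b > 0" "J > 0"
  shows "\<bar>digit_const b r i - (1 / (2 * real b) + real b ^ i / 2 *
              (\<Sum>j<J. 1 / real (b ^ i + r + b * j) - 1 / real (b ^ i + r + b * j + 1)))\<bar>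
           \<le> real b ^ i / (2 * J)"
proof -
  define s where "s = b ^ i + r - 1"
  have s: "b ^ i + r = Suc s" using assms by (simp add: s_def)
  let ?g = "\<lambda>u::real. (1 - u) / (1 - u ^ b)"
  \<comment> \<open>This is the continuous extension of \<open>?g\<close> to \<open>u = 1\<close>.
    It is integrable and bounded by 1, and changing one point leaves the integral the same.\<close>
  let ?G = "\<lambda>u::real. 1 / (\<Sum>j<b. u ^ j)"
  have Gpos: "(\<Sum>j<b. u ^ j) \<ge> 1" if "u \<ge> 0" for u :: real
  proof -
    have "(\<Sum>j<b. u ^ j) \<ge> (\<Sum>j\<in>{0}. u ^ j)"
      using that assms by (intro sum_mono2) auto
    then show ?thesis by simp
  qed
  have gG: "?g u = ?G u" if "u \<in> {0..1} - {1}" for u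
    using that one_diff_power_eq[of u b] Gpos[of u] by auto
  have int: "(\<lambda>u. ?G u * u ^ k) integrable_on {0..1}" for k
  proof (intro integrable_continuous_real continuous_intros)
    show "\<forall>u\<in>{0..1}. (\<Sum>j<b. u ^ j) \<noteq> (0::real)" using Gpos by force
  qed
  have pow: "((\<lambda>u. u ^ k) has_integral 1 / real (Suc k)) {0..1::real}" for k
  proof -
    have "((\<lambda>u. u ^ k) has_integral (1 ^ Suc k / real (Suc k) - 0 ^ Suc k / real (Suc k))) {0..1::real}"
      by (intro fundamental_theorem_of_calculus)
        (auto intro!: derivative_eq_intros simp flip: has_real_derivative_iff_has_vector_derivative
          simp del: of_nat_Suc power_Suc)
    then show ?thesis by simp
  qed
  have "integral {0..1} (\<lambda>u. ?g u * u ^ s) = integral {0..1} (\<lambda>u. ?G u * u ^ s)"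
    by (rule integral_spike[of "{1}"]) (use gG in auto)
  also have "\<dots> = integral {0..1} (\<lambda>u. (\<Sum>j<J. u ^ (s + b * j) - u ^ (Suc s + b * j)) + ?G u * u ^ (s + b * J))"
  proof (rule integral_spike[of "{1}"])
    fix u :: real assume u: "u \<in> {0..1} - {1}"
    have "u ^ b \<noteq> 1" using u assms power_eq_iff_eq_base[of b u 1] by auto
    have "(\<Sum>j<J. u ^ (s + b * j) - u ^ (Suc s + b * j)) = u ^ s * (1 - u) * (\<Sum>j<J. (u ^ b) ^ j)"
    proof -
      have "u ^ (s + b * j) - u ^ (Suc s + b * j) = u ^ s * (1 - u) * (u ^ b) ^ j" for j
        unfolding power_add power_mult power_Suc by (simp add: algebra_simps)
      then show ?thesis by (simp only: sum_distrib_left)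
    qed
    also have "(1 - u ^ b) * (\<Sum>j<J. (u ^ b) ^ j) = 1 - (u ^ b) ^ J"
      by (rule one_diff_power_eq[symmetric])
    then have "(\<Sum>j<J. (u ^ b) ^ j) = (1 - u ^ (b * J)) / (1 - u ^ b)"
      using \<open>u ^ b \<noteq> 1\<close> unfolding power_mult by (simp add: field_simps)
    finally show "(\<Sum>j<J. u ^ (s + b * j) - u ^ (Suc s + b * j)) + ?G u * u ^ (s + b * J) = ?G u * u ^ s"
      unfolding gG[OF u, symmetric] power_add using \<open>u ^ b \<noteq> 1\<close>
      by (simp flip: add_divide_distrib) (simp add: algebra_simps)
  qed auto
  also have "\<dots> = (\<Sum>j<J. 1 / real (Suc (s + b * j)) - 1 / real (Suc (Suc s + b * j)))
      + integral {0..1} (\<lambda>u. ?G u * u ^ (s + b * J))"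
    by (intro integral_unique has_integral_add has_integral_sum has_integral_diff pow
        integrable_integral int) auto
  finally have eq: "integral {0..1} (\<lambda>u. ?g u * u ^ s)
      - (\<Sum>j<J. 1 / real (Suc (s + b * j)) - 1 / real (Suc (Suc s + b * j)))
      = integral {0..1} (\<lambda>u. ?G u * u ^ (s + b * J))" by simp
  have "integral {0..1} (\<lambda>u. ?G u * u ^ (s + b * J)) \<ge> 0"
    by (intro integral_nonneg int) (auto intro!: divide_nonneg_nonneg sum_nonneg mult_nonneg_nonneg)
  moreover have "integral {0..1} (\<lambda>u. ?G u * u ^ (s + b * J)) \<le> 1 / real J"
  proof -
    have "integral {0..1} (\<lambda>u. ?G u * u ^ (s + b * J)) \<le> integral {0..1} (\<lambda>u::real. u ^ (s + b * J))"
    proof (rule integral_le)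
      fix u :: real assume u: "u \<in> {0..1}"
      have "?G u \<le> 1" using Gpos[of u] u by simp
      then have "?G u * u ^ (s + b * J) \<le> 1 * u ^ (s + b * J)"
        using u by (intro mult_right_mono) auto
      then show "?G u * u ^ (s + b * J) \<le> u ^ (s + b * J)" by simp
    qed (use int pow in blast)+
    also have "\<dots> = 1 / real (Suc (s + b * J))" using pow by (rule integral_unique)
    also have "\<dots> \<le> 1 / real J"
    proof (rule divide_left_mono)
      have "1 * J \<le> b * J" using assms by (intro mult_right_mono) auto
      then have "J \<le> Suc (s + b * J)" by linarith
      then show "real J \<le> real (Suc (s + b * J))" by (rule of_nat_mono)
    qed (use assms in \<open>simp_all del: of_nat_Suc\<close>)
    finally show ?thesis .
  qed
  ultimately have *: "\<bar>integral {0..1} (\<lambda>u. ?g u * u ^ s)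
      - (\<Sum>j<J. 1 / real (Suc (s + b * j)) - 1 / real (Suc (Suc s + b * j)))\<bar> \<le> 1 / real J"
    unfolding eq by simp
  have "\<bar>real b ^ i / 2 * (integral {0..1} (\<lambda>u. ?g u * u ^ s)
      - (\<Sum>j<J. 1 / real (Suc (s + b * j)) - 1 / real (Suc (Suc s + b * j))))\<bar>
      \<le> real b ^ i / 2 * (1 / real J)"
    unfolding abs_mult by (intro mult_mono *) auto
  then show ?thesis
    unfolding digit_const_def s by (simp add: algebra_simps)
qed

section \<open>Counting coprime pairs\<close>

text \<open>The digit condition in natural division, with \<open>a = b ^ i\<close>; it is invariant
  under scaling \<open>(n, m)\<close> by a common factor.\<close>

definition pair_count :: "nat \<Rightarrow> nat \<Rightarrow> nat \<Rightarrow> nat \<Rightarrow> nat" where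
  "pair_count a b r N = card {(n, m) \<in> {1..N} \<times> {1..N}. (a * n div m) mod b = r}"

lemma pair_count_estimate:
  fixes b r i N :: nat
  assumes "b > 0" "r < b" "i > 0"
  shows "\<bar>real (pair_count (b ^ i) b r N) - digit_const b r i * (real N)\<^sup>2\<bar>
           \<le> (real b ^ i + 4) * N * (1 + ln N)"
proof (cases "N = 0")
  case True
  then show ?thesis by (simp add: pair_count_def)
next
  case False
  define a where "a = b ^ i"
  have a: "a = b * b ^ (i - 1)" using assms by (cases i) (auto simp: a_def)
  have a0: "a > 0" using assms by (simp add: a_def)
  \<comment> \<open>This size makes the truncation error \<open>a / (2 * J) * N\<^sup>2\<close>
    equal to \<open>N / 2\<close>, and gives the cutoff condition
    \<open>a * N < b * L\<close>.\<close>
  define J where "J = a * N"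
  define L where "L = b ^ (i - 1) + J"
  let ?F = "sector_length N a b r L"
  have L: "a * N < b * L"
  proof -
    have "1 * (a * N) \<le> b * (a * N)" using assms by (intro mult_right_mono) auto
    moreover have "b * L = a + b * (a * N)" by (simp only: L_def J_def distrib_left a[symmetric])
    ultimately show ?thesis using a0 by linarith
  qed
  let ?S = "Sigma {1..N} (\<lambda>m. {n \<in> {1..N}. (a * n div m) mod b = r})"
  have "{(n, m) \<in> {1..N} \<times> {1..N}. (a * n div m) mod b = r} = prod.swap ` ?S"
    by (auto simp: image_iff)
  then have "pair_count a b r N = card ?S"
    unfolding pair_count_def by (simp add: card_image)
  also have "\<dots> = (\<Sum>m = 1..N. card {n \<in> {1..N}. (a * n div m) mod b = r})"
    by (subst card_SigmaI) auto
  finally have "\<bar>real (pair_count a b r N) - (\<Sum>m = 1..N. ?F (real m))\<bar>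
      = \<bar>\<Sum>m = 1..N. real (card {n \<in> {1..N}. (a * n div m) mod b = r}) - ?F (real m)\<bar>"
    by (simp add: sum_subtractf)
  also have "\<dots> \<le> (\<Sum>m = 1..N. (real a + 1) * N / m)"
    by (rule order_trans[OF sum_abs sum_mono]) (use row_count[OF a0 assms(1,2) _ _ L] in auto)
  also have "\<dots> = (real a + 1) * N * (\<Sum>m = 1..N. 1 / real m)"
    by (simp add: sum_distrib_left)
  finally have 1: "\<bar>real (pair_count a b r N) - (\<Sum>m = 1..N. ?F (real m))\<bar>
      \<le> (real a + 1) * N * (\<Sum>m = 1..N. 1 / real m)" .
  have "\<bar>(\<Sum>m = 1..N. ?F (real m)) - integral {0..real N} ?F\<bar> \<le> (\<Sum>m = 1..N. 2 * N / real m)"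
  proof (rule sum_minus_integral_le)
    show "continuous_on UNIV ?F"
      unfolding sector_length_def[abs_def] clip_def using a0 by (intro continuous_intros) auto
  qed (use sector_length_near[OF a0 assms(1,2)] in auto)
  also have "\<dots> = 2 * N * (\<Sum>m = 1..N. 1 / real m)"
    by (simp add: sum_distrib_left)
  finally have 2: "\<bar>(\<Sum>m = 1..N. ?F (real m)) - integral {0..real N} ?F\<bar>
      \<le> 2 * N * (\<Sum>m = 1..N. 1 / real m)" .
  let ?c = "1 / (2 * real b) + real b ^ i / 2 *
              (\<Sum>j<J. 1 / real (b ^ i + r + b * j) - 1 / real (b ^ i + r + b * j + 1))"
  have "integral {0..real N} ?F = ?c * (real N)\<^sup>2"
    unfolding L_def a_def by (rule integral_unique[OF integral_sector_length[OF assms]])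
  then have "\<bar>integral {0..real N} ?F - digit_const b r i * (real N)\<^sup>2\<bar> = \<bar>digit_const b r i - ?c\<bar> * (real N)\<^sup>2"
    by (simp only: left_diff_distrib[symmetric] abs_mult abs_power2 abs_minus_commute[of "digit_const b r i"])
  also have "\<dots> \<le> real b ^ i / (2 * J) * (real N)\<^sup>2"
    using assms a0 False by (intro mult_right_mono digit_const_approx) (auto simp: J_def)
  also have "\<dots> = N / 2"
    using a0 False by (simp add: J_def a_def power2_eq_square)
  finally have 3: "\<bar>integral {0..real N} ?F - digit_const b r i * (real N)\<^sup>2\<bar> \<le> N / 2" .
  \<comment> \<open>The row error contributes \<open>a + 1\<close> and the passage to the integral
    2, both times \<open>N\<close> and a harmonic sum. The truncation error \<open>N / 2\<close>
    accounts for the last unit in \<open>a + 4\<close>.\<close>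
  have "(real a + 3) * N * (\<Sum>m = 1..N. 1 / real m) \<le> (real a + 3) * N * (1 + ln N)"
    by (intro mult_left_mono sum_inverse_le) auto
  moreover have "real N * 1 \<le> N * (1 + ln N)"
    using False by (intro mult_left_mono) auto
  moreover have "(real a + 3) * N * (\<Sum>m = 1..N. 1 / real m)
      = (real a + 1) * N * (\<Sum>m = 1..N. 1 / real m) + 2 * N * (\<Sum>m = 1..N. 1 / real m)"
    by (simp add: algebra_simps)
  moreover have "(real a + 4) * N * (1 + ln N) = (real a + 3) * N * (1 + ln N) + N * (1 + ln N)"
    by (simp add: algebra_simps)
  ultimately have "\<bar>real (pair_count a b r N) - digit_const b r i * (real N)\<^sup>2\<bar>
      \<le> (real a + 4) * N * (1 + ln N)"
    using 1 2 3 by linarith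
  then show ?thesis by (simp add: a_def)
qed

text \<open>The indicator of \<open>gcd n m = 1\<close> is the sum of \<open>moebius\<close> over
  the common divisors \<open>d\<close>. Pairs divisible by \<open>d\<close> are the
  \<open>d\<close>-fold multiples of pairs up to \<open>N div d\<close>, and scaling preserves the
  residue condition.\<close>

lemma coprime_pair_count:
  "real (card {(n, m) \<in> {1..N} \<times> {1..N}. (a * n div m) mod b = r \<and> gcd n m = 1})
     = (\<Sum>d = 1..N. moebius d * real (pair_count a b r (N div d)))"
proof -
  define S where "S = {(n, m) \<in> {1..N} \<times> {1..N}. (a * n div m) mod b = r}"
  have finS: "finite S" by (rule finite_subset[of _ "{1..N} \<times> {1..N}"]) (auto simp: S_def)
  have "{(n, m) \<in> {1..N} \<times> {1..N}. (a * n div m) mod b = r \<and> gcd n m = 1} = {x \<in> S. gcd (fst x) (snd x) = 1}"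
    by (auto simp: S_def)
  then have "real (card {(n, m) \<in> {1..N} \<times> {1..N}. (a * n div m) mod b = r \<and> gcd n m = 1})
      = (\<Sum>x\<in>S. if gcd (fst x) (snd x) = 1 then 1 else 0)"
    using finS by (simp add: sum.If_cases Int_def)
  also have "\<dots> = (\<Sum>x\<in>S. \<Sum>d \<in> {d \<in> {1..N}. d dvd fst x \<and> d dvd snd x}. moebius d)"
  proof (rule sum.cong[OF refl])
    fix x assume "x \<in> S"
    then have x: "fst x \<in> {1..N}" "snd x \<in> {1..N}" by (auto simp: S_def)
    then have eq: "{d \<in> {1..N}. d dvd fst x \<and> d dvd snd x} = {d. d dvd gcd (fst x) (snd x)}"
      by (auto intro!: Suc_leI Nat.gr0I dest: dvd_imp_le)
    have "gcd (fst x) (snd x) > 0" using x by auto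
    from sum_moebius_divisors[OF this] show "(if gcd (fst x) (snd x) = 1 then 1 else 0)
        = (\<Sum>d \<in> {d \<in> {1..N}. d dvd fst x \<and> d dvd snd x}. moebius d)"
      by (simp only: eq)
  qed
  also have "\<dots> = (\<Sum>d = 1..N. \<Sum>x \<in> {x \<in> S. d dvd fst x \<and> d dvd snd x}. moebius d)"
    by (rule sum.swap_restrict) (use finS in auto)
  also have "\<dots> = (\<Sum>d = 1..N. moebius d * real (pair_count a b r (N div d)))"
  proof (rule sum.cong[OF refl])
    fix d assume d: "d \<in> {1..N}"
    let ?P = "{(n, m) \<in> {1..N div d} \<times> {1..N div d}. (a * n div m) mod b = r}"
    have mem: "d * k \<in> {1..N} \<longleftrightarrow> k \<in> {1..N div d}" for k
      using d by (cases "k = 0") (auto simp: less_eq_div_iff_mult_less_eq mult.commute Suc_le_eq)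
    have cancel: "a * (d * k) div (d * l) = a * k div l" for k l
      using d by (simp add: mult.left_commute)
    have "{x \<in> S. d dvd fst x \<and> d dvd snd x} = map_prod ((*) d) ((*) d) ` ?P"
    proof (intro equalityI subsetI)
      fix x assume "x \<in> {x \<in> S. d dvd fst x \<and> d dvd snd x}"
      then obtain k l where x: "x = (d * k, d * l)" "(d * k, d * l) \<in> S"
        by (cases x) (auto elim!: dvdE)
      then have "(k, l) \<in> ?P" using mem cancel by (auto simp: S_def)
      then show "x \<in> map_prod ((*) d) ((*) d) ` ?P" using x(1) by force
    next
      fix x assume "x \<in> map_prod ((*) d) ((*) d) ` ?P"
      then obtain k l where "x = (d * k, d * l)" "(k, l) \<in> ?P" by auto
      then show "x \<in> {x \<in> S. d dvd fst x \<and> d dvd snd x}"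
        using mem cancel unfolding S_def by auto
    qed
    moreover have "inj_on (map_prod ((*) d) ((*) d)) ?P"
      using d by (auto simp: inj_on_def)
    ultimately show "(\<Sum>x \<in> {x \<in> S. d dvd fst x \<and> d dvd snd x}. moebius d)
        = moebius d * real (pair_count a b r (N div d))"
      by (simp add: card_image pair_count_def)
  qed
  finally show ?thesis .
qed

text \<open>Replacing \<open>f (N div d)\<close> by \<open>c * (N / d)\<^sup>2\<close> costs
  \<open>O(N / d * ln N)\<close>, and summing over \<open>d\<close> brings the second logarithm.
  Completing the Moebius sum to \<open>1 / zeta 2\<close> costs only
  \<open>O(N * ln N)\<close>.\<close>

lemma coprime_pair_estimate:
  fixes f :: "nat \<Rightarrow> real"
  assumes "C \<ge> 0" and f: "\<And>N. \<bar>f N - c * (real N)\<^sup>2\<bar> \<le> C * N * (1 + ln N)"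
  shows "\<bar>(\<Sum>d = 1..N. moebius d * f (N div d)) - c / zeta 2 * (real N)\<^sup>2\<bar>
           \<le> (C + 4 * \<bar>c\<bar>) * N * (1 + ln N)\<^sup>2"
proof (cases "N = 0")
  case False
  define l where "l = 1 + ln (real N)"
  have l: "l \<ge> 1" using False by (simp add: l_def)
  let ?H = "\<Sum>d = 1..N. 1 / real d"
  have H: "?H \<le> l" unfolding l_def by (rule sum_inverse_le)
  have "\<bar>\<Sum>d = 1..N. moebius d * f (N div d) - c * (real N)\<^sup>2 * (moebius d / (real d)\<^sup>2)\<bar>
      \<le> (\<Sum>d = 1..N. (C * N * l + 2 * \<bar>c\<bar> * N) * (1 / real d))"
  proof (rule order_trans[OF sum_abs sum_mono])
    fix d assume d: "d \<in> {1..N}"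
    define k where "k = N div d"
    define x where "x = real N / d"
    have k: "1 \<le> k" "k \<le> N" using d by (auto simp: k_def div_greater_zero_iff Suc_le_eq)
    have kx: "real k \<le> x" unfolding k_def x_def by (rule of_nat_div_le_of_nat)
    have "N < (k + 1) * d"
      using d dividend_less_div_times[of d N] by (simp add: k_def)
    then have "real N < (real k + 1) * real d"
      by (metis of_nat_1 of_nat_add of_nat_less_iff of_nat_mult)
    then have xk: "x < k + 1" using d by (simp add: x_def field_simps)
    have "\<bar>f k - c * (real k)\<^sup>2\<bar> \<le> C * k * (1 + ln k)" by (rule f)
    also have "\<dots> \<le> C * x * l"
      using k kx assms(1) unfolding l_def by (intro mult_mono add_left_mono mult_left_mono) auto
    finally have A: "\<bar>f k - c * (real k)\<^sup>2\<bar> \<le> C * x * l" .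
    \<comment> \<open>Here \<open>k\<close> is the integer part of \<open>x\<close>, so the first
      factor is at most 1 and the second at most \<open>2 * x\<close>.\<close>
    have "\<bar>(real k)\<^sup>2 - x\<^sup>2\<bar> = (x - k) * (x + k)"
      using power_mono[OF kx, of 2] by (simp add: power2_eq_square algebra_simps)
    also have "\<dots> \<le> 1 * (2 * x)" using kx xk by (intro mult_mono) auto
    finally have "\<bar>c\<bar> * \<bar>(real k)\<^sup>2 - x\<^sup>2\<bar> \<le> \<bar>c\<bar> * (1 * (2 * x))"
      by (intro mult_left_mono) auto
    then have "\<bar>c * (real k)\<^sup>2 - c * x\<^sup>2\<bar> \<le> 2 * \<bar>c\<bar> * x"
      unfolding abs_mult[symmetric] right_diff_distrib by simp
    with A have B: "\<bar>f k - c * x\<^sup>2\<bar> \<le> C * x * l + 2 * \<bar>c\<bar> * x" by linarith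
    have "\<bar>moebius d * f k - c * (real N)\<^sup>2 * (moebius d / (real d)\<^sup>2)\<bar> = \<bar>moebius d\<bar> * \<bar>f k - c * x\<^sup>2\<bar>"
      by (simp add: x_def power_divide algebra_simps flip: abs_mult)
    also have "\<dots> \<le> 1 * (C * x * l + 2 * \<bar>c\<bar> * x)"
      by (intro mult_mono abs_moebius_le B) auto
    also have "\<dots> = (C * N * l + 2 * \<bar>c\<bar> * N) * (1 / real d)"
      by (simp add: x_def add_divide_distrib)
    finally show "\<bar>moebius d * f (N div d) - c * (real N)\<^sup>2 * (moebius d / (real d)\<^sup>2)\<bar>
        \<le> (C * N * l + 2 * \<bar>c\<bar> * N) * (1 / real d)" by (simp only: k_def)
  qed
  also have "\<dots> = (C * N * l + 2 * \<bar>c\<bar> * N) * ?H"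
    by (simp add: sum_distrib_left)
  also have "\<dots> \<le> (C * N * l + 2 * \<bar>c\<bar> * N) * l"
    using assms(1) l H by (intro mult_left_mono) auto
  finally have 1: "\<bar>(\<Sum>d = 1..N. moebius d * f (N div d)) - c * (real N)\<^sup>2 * (\<Sum>d = 1..N. moebius d / (real d)\<^sup>2)\<bar>
      \<le> (C * N * l + 2 * \<bar>c\<bar> * N) * l"
    by (simp add: sum_subtractf sum_distrib_left)
  have "\<bar>c * (real N)\<^sup>2 * ((\<Sum>d = 1..N. moebius d / (real d)\<^sup>2) - 1 / zeta 2)\<bar>
      \<le> \<bar>c * (real N)\<^sup>2\<bar> * (2 * l / N)"
    unfolding abs_mult[of "c * (real N)\<^sup>2"] l_def using False
    by (intro mult_left_mono sum_moebius_squares) auto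
  also have "\<dots> = 2 * \<bar>c\<bar> * N * l"
    using False by (simp add: abs_mult power2_eq_square)
  finally have 2: "\<bar>c * (real N)\<^sup>2 * (\<Sum>d = 1..N. moebius d / (real d)\<^sup>2) - c / zeta 2 * (real N)\<^sup>2\<bar> \<le> 2 * \<bar>c\<bar> * N * l"
    by (simp add: algebra_simps)
  \<comment> \<open>Rounding and completing the sum each contribute
    \<open>2 * \<bar>c\<bar> * N * l\<close>; a factor \<open>l \<ge> 1\<close> is spent to match
    the main error.\<close>
  have "4 * \<bar>c\<bar> * N * l * 1 \<le> 4 * \<bar>c\<bar> * N * l * l"
    using l by (intro mult_left_mono) auto
  with 1 2 show ?thesis
    unfolding l_def[symmetric] by (simp add: algebra_simps power2_eq_square)
qed simp

section \<open>From digits to residues, and the final estimate\<close>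

lemma base_digit_eq_iff:
  assumes "b > 0" "i > 0"
  shows "base_digit (real n / real m) b i = int r \<longleftrightarrow> (b ^ i * n div m) mod b = r"
proof -
  define y where "y = real b ^ (i - 1) * (real n / real m)"
  have by_eq: "real b * y = real (b ^ i * n) / real m"
    using assms by (cases i) (auto simp: y_def)
  have floor_by: "\<lfloor>real b * y\<rfloor> = int (b ^ i * n div m)"
    unfolding by_eq by (rule floor_divide_of_nat_eq)
  \<comment> \<open>Dividing by the integer \<open>b\<close> commutes with taking floors, so
    \<open>b * frac y\<close> has floor \<open>Q - b * (Q div b) = Q mod b\<close> with
    \<open>Q = b ^ i * n div m\<close>.\<close>
  have "\<lfloor>y\<rfloor> = \<lfloor>real b * y / real_of_int (int b)\<rfloor>" using assms by simp
  also have "\<dots> = int (b ^ i * n div m) div int b"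
    unfolding floor_by[symmetric] by (rule floor_divide_real_eq_div) simp
  finally have "real b * frac y = real b * y - of_int (int b * (int (b ^ i * n div m) div int b))"
    by (simp add: frac_def right_diff_distrib)
  then have "base_digit (real n / real m) b i = int (b ^ i * n div m) - int b * (int (b ^ i * n div m) div int b)"
    unfolding base_digit_def y_def[symmetric] by (simp only: floor_diff_of_int floor_by)
  also have "\<dots> = int (b ^ i * n div m mod b)"
    by (simp add: minus_mult_div_eq_mod zmod_int)
  finally show ?thesis by simp
qed

theorem theorem2p3:
  fixes b r i :: nat
  assumes "b \<ge> 2" and "r \<in> {0..b - 1}" and "i \<ge> 1"
  shows "(\<lambda>T::real. (\<Sum>(n, m) \<in> {(n, m) \<in> digit_pairs T b r i. gcd n m = 1}. 1)
            - digit_const b r i / zeta 2 * T\<^sup>2)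
         \<in> O[at_top](\<lambda>T. T * (ln T)\<^sup>2)"
proof -
  have pos: "b > 0" "r < b" "i > 0" using assms by auto
  define c where "c = digit_const b r i"
  define C where "C = real b ^ i + 4 + 4 * \<bar>c\<bar>"
  define E where "E T = (\<Sum>(n, m) \<in> {(n, m) \<in> digit_pairs T b r i. gcd n m = 1}. 1) - c / zeta 2 * T\<^sup>2" for T :: real
  \<comment> \<open>For \<open>T \<ge> 3 \<ge> exp 1\<close> one has \<open>ln T \<ge> 1\<close>, so
    \<open>1 + ln N \<le> 2 * ln T\<close>; squaring gives the factor 4. The other term pays for
    replacing \<open>N\<^sup>2\<close> by \<open>T\<^sup>2\<close>.\<close>
  have "\<bar>E T\<bar> \<le> (4 * C + 2 * \<bar>c / zeta 2\<bar>) * \<bar>T * (ln T)\<^sup>2\<bar>" if T: "T \<ge> 3" for T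
  proof -
    define N where "N = nat \<lfloor>T\<rfloor>"
    have N: "real N \<le> T" "T < real N + 1" "1 \<le> N" using T unfolding N_def by linarith+
    have "exp 1 \<le> T" using T exp_le by linarith
    then have lnT: "ln T \<ge> 1" using T by (subst ln_ge_iff) auto
    have "real n \<in> {1..T} \<longleftrightarrow> n \<in> {1..N}" for n
      using N T by (auto simp: N_def le_nat_iff le_floor_iff)
    then have "{(n, m) \<in> digit_pairs T b r i. gcd n m = 1}
        = {(n, m) \<in> {1..N} \<times> {1..N}. (b ^ i * n div m) mod b = r \<and> gcd n m = 1}"
      unfolding digit_pairs_def using base_digit_eq_iff[OF pos(1,3)] by auto
    then have "(\<Sum>(n, m) \<in> {(n, m) \<in> digit_pairs T b r i. gcd n m = 1}. 1 :: real)
        = (\<Sum>d = 1..N. moebius d * real (pair_count (b ^ i) b r (N div d)))"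
      unfolding coprime_pair_count[symmetric] by simp
    moreover have "\<bar>(\<Sum>d = 1..N. moebius d * real (pair_count (b ^ i) b r (N div d))) - c / zeta 2 * (real N)\<^sup>2\<bar>
        \<le> C * N * (1 + ln N)\<^sup>2"
      unfolding C_def using pair_count_estimate[OF pos] 
      by (intro coprime_pair_estimate) (auto simp: c_def)
    moreover have "C * N * (1 + ln N)\<^sup>2 \<le> C * T * (2 * ln T)\<^sup>2"
    proof -
      have "ln N \<le> ln T" using N by simp
      then have "1 + ln N \<le> 2 * ln T" using lnT by linarith
      then show ?thesis using N by (intro mult_mono power_mono) (auto simp: C_def)
    qed
    moreover have "\<bar>c / zeta 2 * (real N)\<^sup>2 - c / zeta 2 * T\<^sup>2\<bar> \<le> 2 * \<bar>c / zeta 2\<bar> * (T * (ln T)\<^sup>2)"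
    proof -
      have "\<bar>(real N)\<^sup>2 - T\<^sup>2\<bar> = (T - N) * (T + N)"
        using power_mono[OF N(1), of 2] by (simp add: power2_eq_square algebra_simps)
      also have "\<dots> \<le> 1 * (2 * T)" using N by (intro mult_mono) auto
      also have "\<dots> \<le> 2 * (T * (ln T)\<^sup>2)"
        using T lnT by simp
      finally have "\<bar>c / zeta 2\<bar> * \<bar>(real N)\<^sup>2 - T\<^sup>2\<bar> \<le> \<bar>c / zeta 2\<bar> * (2 * (T * (ln T)\<^sup>2))"
        by (intro mult_left_mono) auto
      then show ?thesis unfolding abs_mult[symmetric] by (simp add: algebra_simps)
    qed
    ultimately have "\<bar>E T\<bar> \<le> C * T * (2 * ln T)\<^sup>2 + 2 * \<bar>c / zeta 2\<bar> * (T * (ln T)\<^sup>2)"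
      unfolding E_def by linarith
    also have "\<dots> = (4 * C + 2 * \<bar>c / zeta 2\<bar>) * \<bar>T * (ln T)\<^sup>2\<bar>"
      using T by (simp add: power_mult_distrib algebra_simps)
    finally show ?thesis .
  qed
  then have "E \<in> O[at_top](\<lambda>T. T * (ln T)\<^sup>2)"
    by (intro bigoI[where c = "4 * C + 2 * \<bar>c / zeta 2\<bar>"] eventually_at_top_linorderI[of 3]) simp
  then show ?thesis unfolding E_def c_def .
qed

end
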